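(* For a fixed $k \geq 0$, let $\mathcal{S}_n^k$ be the collection of all configurations of $n$ points on a circle such that $n-k$ of the points form a regular $(n-k)$-gon and the remaining $k$ points are placed arbitrarily on the circle. Then $$\max_{\mathcal{P} \in \mathcal{S}_n^k} A(\mathcal{P}) = \Theta(nk).$$
   Context: For a finite set $\mathcal P \subset \mathbb{R}^2$, $A(\mathcal P)$ denotes the number of distinct angles in the open interval $(0,\pi)$ determined by triples of distinct points of $\mathcal P$ (angles of $0$ and $\pi$ are not counted). $f = O(g)$ means there is a constant $C$ with $f(n) \le C g(n)$ for all sufficiently large $n$; $f=\Omega(g)$ means $g = O(f)$; $f=\Theta(g)$ means both $f=O(g)$ and $f=\Omega(g)$.
   Formalization: For k = 0 the claim Θ(nk) = Θ(0) is false, since a regular n-gon has n − 2 distinct angles; the result is therefore stated as Θ(nk) for every k ≥ 1 (also with constants independent of k), and as Θ(n) for k = 0. *)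

theory Defs
  imports "HOL-Analysis.Analysis" "HOL-Library.Landau_Symbols"
begin

text \<open>The angle at the vertex \<open>q\<close>, in \<open>[0, pi]\<close>; meaningful for \<open>p \<noteq> q\<close> and \<open>r \<noteq> q\<close>.\<close>

definition angle_at :: "real^2 \<Rightarrow> real^2 \<Rightarrow> real^2 \<Rightarrow> real" where
  "angle_at p q r = arccos (((p - q) \<bullet> (r - q)) / (norm (p - q) * norm (r - q)))"

definition angles :: "(real^2) set \<Rightarrow> real set" where
  "angles P = {\<alpha>. 0 < \<alpha> \<and> \<alpha> < pi \<and>
     (\<exists>p\<in>P. \<exists>q\<in>P. \<exists>r\<in>P. p \<noteq> q \<and> q \<noteq> r \<and> p \<noteq> r \<and> \<alpha> = angle_at p q r)}"

definition num_angles :: "(real^2) set \<Rightarrow> nat" where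
  "num_angles P = card (angles P)"

definition circle_point :: "real^2 \<Rightarrow> real \<Rightarrow> real \<Rightarrow> real^2" where
  "circle_point c \<rho> t = c + \<rho> *\<^sub>R vector [cos t, sin t]"

text \<open>\<open>Q\<close> is the vertex set of a regular \<open>m\<close>-gon, \<open>m \<ge> 3\<close>, inscribed in the circle with
  centre \<open>c\<close> and radius \<open>\<rho>\<close>.\<close>

definition regular_polygon_on :: "real^2 \<Rightarrow> real \<Rightarrow> nat \<Rightarrow> (real^2) set \<Rightarrow> bool" where
  "regular_polygon_on c \<rho> m Q \<longleftrightarrow> 3 \<le> m \<and> 0 < \<rho> \<and>
     (\<exists>t. Q = (\<lambda>j. circle_point c \<rho> (t + 2 * pi * real j / real m)) ` {..<m})"

text \<open>The truncated subtraction is harmless: a regular \<open>(n - k)\<close>-gon requires \<open>n \<ge> k + 3\<close>,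
  so the collection is empty for smaller \<open>n\<close>.\<close>

definition configs :: "nat \<Rightarrow> nat \<Rightarrow> (real^2) set set" where
  "configs n k = {P. finite P \<and> card P = n \<and>
     (\<exists>c \<rho>. 0 < \<rho> \<and> P \<subseteq> sphere c \<rho> \<and> (\<exists>Q\<subseteq>P. regular_polygon_on c \<rho> (n - k) Q))}"

definition max_angles :: "nat \<Rightarrow> nat \<Rightarrow> nat" where
  "max_angles n k = Max (num_angles ` configs n k)"

text \<open>The maximum is a genuine one for \<open>n \<ge> k + 3\<close>: the set of values is finite and nonempty.\<close>

lemma finite_num_angles_configs: "finite (num_angles ` configs n k)"
proof (rule finite_subset)
  show "num_angles ` configs n k \<subseteq> {..n * (n * n)}"
  proof (intro image_subsetI)
    fix P assume "P \<in> configs n k"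
    then have P: "finite P" "card P = n" by (auto simp: configs_def)
    have "angles P \<subseteq> (\<lambda>(p, q, r). angle_at p q r) ` (P \<times> P \<times> P)"
      by (force simp: angles_def)
    then have "card (angles P) \<le> card (P \<times> P \<times> P)"
      using P by (intro surj_card_le) auto
    then show "num_angles P \<in> {..n * (n * n)}"
      using P by (simp add: num_angles_def card_cartesian_product)
  qed
qed simp

lemma circle_point_nth [simp]:
  "circle_point c \<rho> t $ 1 = c $ 1 + \<rho> * cos t" "circle_point c \<rho> t $ 2 = c $ 2 + \<rho> * sin t"
  by (simp_all add: circle_point_def)

lemma circle_point_in_sphere: "0 \<le> \<rho> \<Longrightarrow> circle_point c \<rho> t \<in> sphere c \<rho>"
proof -
  assume "0 \<le> \<rho>"
  have "norm (vector [cos t, sin t] :: real^2) = 1"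
    by (simp add: norm_vec_def L2_set_def sum_2)
  then show ?thesis
    using \<open>0 \<le> \<rho>\<close> by (simp add: circle_point_def dist_norm)
qed

lemma circle_point_inj:
  assumes "0 < \<rho>" shows "inj_on (circle_point c \<rho>) {0..<2 * pi}"
proof (rule inj_onI)
  fix s t assume st: "s \<in> {0..<2 * pi}" "t \<in> {0..<2 * pi}"
    and eq: "circle_point c \<rho> s = circle_point c \<rho> t"
  from eq have "circle_point c \<rho> s $ 1 = circle_point c \<rho> t $ 1"
    "circle_point c \<rho> s $ 2 = circle_point c \<rho> t $ 2" by simp_all
  then have "sin s = sin t \<and> cos s = cos t" using assms by simp
  then obtain i where i: "s = t + 2 * pi * of_int i"
    unfolding sin_cos_eq_iff by blast
  have "2 * pi * of_int i < 2 * pi * 1" "2 * pi * (-1) < 2 * pi * of_int i"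
    using st i unfolding atLeastLessThan_iff by linarith+
  then have "real_of_int i < 1" "-1 < real_of_int i"
    using mult_less_cancel_left_pos[of "2 * pi" "of_int i" 1]
      mult_less_cancel_left_pos[of "2 * pi" "-1" "of_int i"] pi_gt_zero by linarith+
  then have "i = 0" by linarith
  then show "s = t" using i by simp
qed

lemma configs_nonempty:
  assumes "k + 3 \<le> n" shows "configs n k \<noteq> {}"
proof -
  define m where "m = n - k"
  define f :: "nat \<Rightarrow> real^2" where "f j = circle_point 0 1 (0 + 2 * pi * real j / real m)" for j
  define Q where "Q = f ` {..<m}"
  have m: "3 \<le> m" using assms by (simp add: m_def)
  have inj: "inj_on f {..<m}"
  proof (rule inj_onI)
    fix i j assume ij: "i \<in> {..<m}" "j \<in> {..<m}" "f i = f j"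
    then have "2 * pi * real i / real m = 2 * pi * real j / real m"
      using m by (intro inj_onD[OF circle_point_inj[of 1 0]]) (auto simp: f_def field_simps)
    then show "i = j" using m by (simp add: field_simps)
  qed
  then have Q: "card Q = m" "finite Q" by (auto simp: Q_def card_image)
  have QS: "Q \<subseteq> sphere 0 1" unfolding Q_def f_def
    by (intro image_subsetI circle_point_in_sphere) simp
  have "infinite (circle_point 0 1 ` {0..<2 * pi})"
    using finite_imageD[OF _ circle_point_inj[of 1 0]] by (auto simp: infinite_Ico)
  then have "infinite (sphere (0::real^2) 1)"
    by (rule infinite_super[rotated]) (intro image_subsetI circle_point_in_sphere, simp)
  then have "infinite (sphere (0::real^2) 1 - Q)" using Q by simp
  then obtain R where R: "finite R" "card R = k" "R \<subseteq> sphere 0 1 - Q"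
    by (meson infinite_arbitrarily_large)
  have "card (Q \<union> R) = n"
    using R Q assms by (subst card_Un_disjoint) (auto simp: m_def)
  moreover have "regular_polygon_on 0 1 (n - k) Q"
    using m unfolding regular_polygon_on_def Q_def f_def m_def by (intro conjI exI[of _ 0]) auto
  ultimately have "Q \<union> R \<in> configs n k"
    unfolding configs_def using Q R QS zero_less_one[where 'a = real]
    by (blast intro: finite_UnI)
  then show ?thesis by blast
qed

end

theory Submission
  imports Defs
begin

text \<open>An inscribed angle depends on its vertex only up to replacing \<open>\<alpha>\<close> by \<open>pi - \<alpha>\<close>, so a pair of
  points of the circle accounts for at most two angles. The pairs inside the regular \<open>m\<close>-gon have
  at most \<open>m\<close> chord lengths, and at most \<open>k * n\<close> pairs involve one of the \<open>k\<close> other points; this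
  gives at most \<open>2 * (k + 1) * n\<close> angles. Conversely, put the other points at fractions \<open>i / (k + 1)\<close> of
  one of the arcs between consecutive vertices: seen from the last vertex, the pairs formed by one
  of these points or the first vertex, and one of the next \<open>m - 2\<close> vertices, give
  \<open>(k + 1) * (m - 2)\<close> distinct angles.\<close>

section \<open>Chords and inscribed angles of a circle\<close>

text \<open>By the sum-to-product formulas the chord is a signed multiple of the unit tangent at the
  mean parameter; lengths and inner products of chords can then be read off.\<close>

lemma circle_point_diff:
  "circle_point c \<rho> a - circle_point c \<rho> b =
    (2 * \<rho> * sin ((a - b) / 2)) *\<^sub>R vector [- sin ((a + b) / 2), cos ((a + b) / 2)]"
proof -
  have "sin ((b - a) / 2) = - sin ((a - b) / 2)"
    using sin_minus[of "(a - b) / 2"] by (simp add: minus_divide_left)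
  then have "cos a - cos b = - 2 * sin ((a - b) / 2) * sin ((a + b) / 2)"
    by (simp add: cos_diff_cos)
  moreover have "sin a - sin b = 2 * sin ((a - b) / 2) * cos ((a + b) / 2)"
    by (simp add: sin_diff_sin)
  ultimately show ?thesis
    by (simp add: vec_eq_iff forall_2 right_diff_distrib[symmetric])
qed

lemma norm_circle_point_diff:
  "norm (circle_point c \<rho> a - circle_point c \<rho> b) = 2 * \<bar>\<rho>\<bar> * \<bar>sin ((a - b) / 2)\<bar>"
proof -
  have "norm (vector [- sin ((a + b) / 2), cos ((a + b) / 2)] :: real^2) = 1"
    by (simp add: norm_vec_def L2_set_def sum_2)
  then show ?thesis
    by (simp add: circle_point_diff abs_mult)
qed

lemma inner_circle_point_diff:
  "(circle_point c \<rho> a - circle_point c \<rho> d) \<bullet> (circle_point c \<rho> b - circle_point c \<rho> d) =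
    4 * \<rho>\<^sup>2 * (sin ((a - d) / 2) * sin ((b - d) / 2)) * cos ((a - b) / 2)"
proof -
  \<comment> \<open>The tangent directions of the two chords from \<open>d\<close> differ by
    \<open>(a - b) / 2\<close>: the parameter \<open>d\<close> cancels, which is the inscribed angle
    theorem.\<close>
  have "cos ((a - b) / 2) = cos ((a + d) / 2 - (b + d) / 2)"
    by (simp add: diff_divide_distrib add_divide_distrib)
  then have "cos ((a - b) / 2) = cos ((a + d) / 2) * cos ((b + d) / 2) + sin ((a + d) / 2) * sin ((b + d) / 2)"
    by (simp add: cos_diff)
  then show ?thesis
    by (simp add: circle_point_diff inner_vec_def sum_2 power2_eq_square algebra_simps)
qed

text \<open>Dividing the inner product by the two lengths leaves the vertex parameter
  \<open>d\<close> only in a sign, which tells on which arc the vertex lies.\<close>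

lemma angle_at_circle_point:
  assumes "\<rho> \<noteq> 0"
  shows "angle_at (circle_point c \<rho> a) (circle_point c \<rho> d) (circle_point c \<rho> b) =
    arccos (sgn (sin ((a - d) / 2) * sin ((b - d) / 2)) * cos ((a - b) / 2))"
proof -
  define s where "s = sin ((a - d) / 2) * sin ((b - d) / 2)"
  have "2 * \<bar>\<rho>\<bar> * \<bar>sin ((a - d) / 2)\<bar> * (2 * \<bar>\<rho>\<bar> * \<bar>sin ((b - d) / 2)\<bar>) = 4 * \<bar>\<rho>\<bar>\<^sup>2 * \<bar>s\<bar>"
    by (simp add: s_def abs_mult power2_eq_square del: abs_mult_self_eq)
  then have "angle_at (circle_point c \<rho> a) (circle_point c \<rho> d) (circle_point c \<rho> b) =
    arccos ((4 * \<rho>\<^sup>2 * s * cos ((a - b) / 2)) / (4 * \<rho>\<^sup>2 * \<bar>s\<bar>))"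
    unfolding angle_at_def norm_circle_point_diff inner_circle_point_diff s_def by simp
  \<comment> \<open>For \<open>s = 0\<close>, where the vertex coincides with an endpoint, both
    sides are 0, since division by zero gives 0.\<close>
  also have "(4 * \<rho>\<^sup>2 * s * cos ((a - b) / 2)) / (4 * \<rho>\<^sup>2 * \<bar>s\<bar>) = sgn s * cos ((a - b) / 2)"
    using assms by (cases "s = 0") (auto simp: sgn_if)
  finally show ?thesis by (simp add: s_def)
qed

lemma sphere_eq_circle_point:
  assumes "0 < \<rho>" "p \<in> sphere c \<rho>"
  obtains t where "p = circle_point c \<rho> t"
proof -
  have "(dist c p)\<^sup>2 = (p $ 1 - c $ 1)\<^sup>2 + (p $ 2 - c $ 2)\<^sup>2"
    by (simp add: dist_norm power2_commute norm_vec_def L2_set_def sum_2)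
  then have "((p $ 1 - c $ 1)\<^sup>2 + (p $ 2 - c $ 2)\<^sup>2) / \<rho>\<^sup>2 = \<rho>\<^sup>2 / \<rho>\<^sup>2"
    using assms by simp
  then have "((p $ 1 - c $ 1) / \<rho>)\<^sup>2 + ((p $ 2 - c $ 2) / \<rho>)\<^sup>2 = 1"
    using assms by (simp add: power_divide add_divide_distrib)
  then obtain t where "(p $ 1 - c $ 1) / \<rho> = cos t" "(p $ 2 - c $ 2) / \<rho> = sin t"
    using sincos_total_2pi by metis
  then have "p = circle_point c \<rho> t"
    using assms by (simp add: vec_eq_iff forall_2 field_simps)
  then show thesis by (rule that)
qed

text \<open>The angles over a chord seen from its two arcs. Taking \<open>arccos\<close> of a cosine
  folds \<open>s / 2\<close> into the range from 0 to pi, so parameters need no normalisation: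
  shifting \<open>s\<close> by a full turn merely swaps the two values.\<close>

definition inscribed_angles :: "real \<Rightarrow> real set" where
  "inscribed_angles s = {arccos (cos (s / 2)), arccos (- cos (s / 2))}"

lemma inscribed_angles_minus: "inscribed_angles (- s) = inscribed_angles s"
  by (simp add: inscribed_angles_def)

lemma inscribed_angles_diff_commute: "inscribed_angles (a - b) = inscribed_angles (b - a)"
  using inscribed_angles_minus[of "a - b"] by simp

lemma finite_inscribed_angles: "finite (inscribed_angles s)"
  by (simp add: inscribed_angles_def)

lemma card_UN_inscribed_angles_le:
  assumes "finite I"
  shows "card (\<Union>i\<in>I. inscribed_angles (f i)) \<le> 2 * card I"
proof -
  have "card (inscribed_angles s) \<le> 2" for s
    unfolding inscribed_angles_def by (simp add: card_insert_if)
  then have "(\<Sum>i\<in>I. card (inscribed_angles (f i))) \<le> card I * 2"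
    by (metis sum_bounded_above of_nat_id)
  then show ?thesis
    using card_UN_le[OF assms, of "\<lambda>i. inscribed_angles (f i)"] by simp
qed

text \<open>As the vertex differs from both endpoints, neither sine vanishes and the sign is 1 or
  -1.\<close>

lemma angle_at_in_inscribed_angles:
  assumes "0 < \<rho>" "q \<in> sphere c \<rho>" "circle_point c \<rho> a \<noteq> q" "circle_point c \<rho> b \<noteq> q"
  shows "angle_at (circle_point c \<rho> a) q (circle_point c \<rho> b) \<in> inscribed_angles (a - b)"
proof -
  obtain d where d: "q = circle_point c \<rho> d"
    using assms sphere_eq_circle_point by blast
  have "sin ((a - d) / 2) \<noteq> 0" "sin ((b - d) / 2) \<noteq> 0"
    using assms norm_circle_point_diff[of c \<rho> a d] norm_circle_point_diff[of c \<rho> b d]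
    unfolding d by auto
  then have "sgn (sin ((a - d) / 2) * sin ((b - d) / 2)) \<in> {-1, 1}"
    by (auto simp: sgn_if)
  then show ?thesis
    using assms(1) unfolding d inscribed_angles_def by (subst angle_at_circle_point) auto
qed

text \<open>The vertex follows both endpoints within one turn, so both sines are negative and the
  sign is 1; \<open>(b - a) / 2\<close> lies between 0 and pi, where \<open>arccos\<close> inverts
  \<open>cos\<close>.\<close>

lemma angle_at_circle_point_ordered:
  assumes "\<rho> \<noteq> 0" "a < b" "b < d" "d < a + 2 * pi"
  shows "angle_at (circle_point c \<rho> a) (circle_point c \<rho> d) (circle_point c \<rho> b) = (b - a) / 2"
proof -
  have *: "sin ((x - d) / 2) < 0" if "x < d" "d < x + 2 * pi" for x
  proof -
    have "0 < sin ((d - x) / 2)" using that by (intro sin_gt_zero) auto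
    also have "sin ((d - x) / 2) = - sin ((x - d) / 2)"
      using sin_minus[of "(x - d) / 2"] by (simp add: minus_divide_left)
    finally show ?thesis by simp
  qed
  have "sin ((a - d) / 2) * sin ((b - d) / 2) > 0"
    using assms by (intro mult_neg_neg *) auto
  moreover have "cos ((a - b) / 2) = cos ((b - a) / 2)"
    using cos_minus[of "(a - b) / 2"] by (simp add: minus_divide_left)
  ultimately show ?thesis
    using assms by (simp add: angle_at_circle_point arccos_cos)
qed

section \<open>Upper bound\<close>

lemma num_angles_configs_le:
  assumes P: "P \<in> configs n k"
  shows "num_angles P \<le> 2 * ((k + 1) * n)"
proof -
  define m where "m = n - k"
  obtain c \<rho> Q where fin: "finite P" "card P = n" and \<rho>: "0 < \<rho>" "P \<subseteq> sphere c \<rho>"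
    and QP: "Q \<subseteq> P" and reg: "regular_polygon_on c \<rho> m Q"
    using P unfolding configs_def m_def by auto
  obtain t where m: "3 \<le> m" and
    Q: "Q = (\<lambda>j. circle_point c \<rho> (t + 2 * pi * real j / real m)) ` {..<m}"
    using reg unfolding regular_polygon_on_def by auto
  \<comment> \<open>Distinctness of the \<open>m\<close> vertices is what leaves exactly
    \<open>k\<close> further points in \<open>R\<close>.\<close>
  have cQ: "card Q = m"
  proof -
    have "inj_on (\<lambda>j. circle_point c \<rho> (t + 2 * pi * real j / real m)) {..<m}"
    proof (rule inj_onI)
      fix i j assume ij: "i \<in> {..<m}" "j \<in> {..<m}"
        and eq: "circle_point c \<rho> (t + 2 * pi * real i / real m) =
          circle_point c \<rho> (t + 2 * pi * real j / real m)"
      \<comment> \<open>Half the parameter difference: a chord of length 0 gives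
        \<open>sin x = 0\<close>, and \<open>x\<close> lies strictly between \<open>- pi\<close> and
        \<open>pi\<close>.\<close>
      define x where "x = (t + 2 * pi * real i / real m - (t + 2 * pi * real j / real m)) / 2"
      have "sin x = 0"
        using norm_circle_point_diff[of c \<rho> "t + 2 * pi * real i / real m" "t + 2 * pi * real j / real m"]
          eq \<rho> by (simp add: x_def)
      moreover have "x = pi * ((real i - real j) / real m)"
        by (simp add: x_def diff_divide_distrib right_diff_distrib)
      moreover have "\<bar>(real i - real j) / real m\<bar> < 1"
        using ij m by (simp add: field_simps abs_less_iff)
      ultimately have "sin x = 0" "- pi < x" "x < pi"
        using mult_strict_left_mono[of "- 1" "(real i - real j) / real m" pi]
          mult_strict_left_mono[of "(real i - real j) / real m" 1 pi]
        unfolding abs_less_iff by (simp_all only: pi_gt_zero mult_1_right mult_minus_right minus_less_iff)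
      then have "x = 0" by (simp add: sin_eq_0_pi)
      then show "i = j" using \<open>x = pi * _\<close> m by simp
    qed
    then show ?thesis by (simp add: Q card_image)
  qed
  define R where "R = P - Q"
  have R: "finite R" "card R = k"
    using fin QP cQ m finite_subset[OF QP] unfolding R_def m_def by (auto simp: card_Diff_subset)
  have "\<exists>\<phi>. \<forall>p\<in>P. p = circle_point c \<rho> (\<phi> p)"
    using \<rho> sphere_eq_circle_point by (intro bchoice) blast
  then obtain \<phi> where \<phi>: "\<And>p. p \<in> P \<Longrightarrow> circle_point c \<rho> (\<phi> p) = p" by metis
  \<comment> \<open>\<open>A\<close> covers chords of the polygon, which matter only through the
    difference of the two indices up to sign; \<open>B\<close> below covers chords with an endpoint
    in \<open>R\<close>, listed first.\<close>
  define A where "A = (\<Union>d\<in>{..<m}. inscribed_angles (2 * pi * real d / real m))"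
  have A_upper: "inscribed_angles (2 * pi * real d / real m) \<subseteq> A" if "d < m" for d
    using that unfolding A_def by blast
  define B where "B = (\<Union>x\<in>R \<times> P. inscribed_angles (\<phi> (fst x) - \<phi> (snd x)))"
  have "angles P \<subseteq> A \<union> B"
  proof
    fix \<alpha> assume "\<alpha> \<in> angles P"
    then obtain p q r where pqr: "p \<in> P" "q \<in> P" "r \<in> P" "p \<noteq> q" "q \<noteq> r"
      and \<alpha>: "\<alpha> = angle_at p q r" unfolding angles_def by blast
    have q: "q \<in> sphere c \<rho>" using pqr \<rho> by auto
    show "\<alpha> \<in> A \<union> B"
    proof (cases "p \<in> Q \<and> r \<in> Q")
      case True
      then obtain i j where ij: "i < m" "j < m" and
        p: "p = circle_point c \<rho> (t + 2 * pi * real i / real m)" and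
        r: "r = circle_point c \<rho> (t + 2 * pi * real j / real m)"
        unfolding Q by auto
      have "\<alpha> \<in> inscribed_angles (2 * pi * real i / real m - 2 * pi * real j / real m)"
        using angle_at_in_inscribed_angles[OF \<rho>(1) q, of "t + 2 * pi * real i / real m"
            "t + 2 * pi * real j / real m"] pqr unfolding \<alpha> p r by auto
      also have "\<dots> \<subseteq> A"
      proof (cases "j \<le> i")
        case True
        then have "2 * pi * real i / real m - 2 * pi * real j / real m = 2 * pi * real (i - j) / real m"
          by (simp add: of_nat_diff right_diff_distrib diff_divide_distrib)
        then show ?thesis using A_upper[of "i - j"] ij by simp
      next
        case False
        then have "2 * pi * real j / real m - 2 * pi * real i / real m = 2 * pi * real (j - i) / real m"
          by (simp add: of_nat_diff right_diff_distrib diff_divide_distrib)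
        then show ?thesis using A_upper[of "j - i"] ij
          by (subst inscribed_angles_diff_commute) simp
      qed
      finally show ?thesis by simp
    next
      case False
      have "\<alpha> \<in> inscribed_angles (\<phi> p - \<phi> r)"
        using angle_at_in_inscribed_angles[OF \<rho>(1) q, of "\<phi> p" "\<phi> r"] pqr \<phi> \<alpha> by auto
      moreover have "(p, r) \<in> R \<times> P \<or> (r, p) \<in> R \<times> P"
        using False pqr by (auto simp: R_def)
      ultimately have "\<alpha> \<in> B"
        unfolding B_def using inscribed_angles_diff_commute by fastforce
      then show ?thesis by simp
    qed
  qed
  moreover have "finite (A \<union> B)"
    using R fin unfolding A_def B_def by (auto intro: finite_inscribed_angles)
  ultimately have "card (angles P) \<le> card (A \<union> B)" by (rule card_mono[rotated])
  also have "\<dots> \<le> card A + card B" by (rule card_Un_le)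
  also have "\<dots> \<le> 2 * m + 2 * (k * n)"
    unfolding A_def B_def
    using card_UN_inscribed_angles_le[of "{..<m}"] card_UN_inscribed_angles_le[of "R \<times> P"] R fin
    by (intro add_mono) (auto simp: card_cartesian_product)
  \<comment> \<open>Here \<open>m \<le> n\<close> is used.\<close>
  also have "\<dots> \<le> 2 * ((k + 1) * n)" by (simp add: m_def)
  finally show ?thesis by (simp add: num_angles_def)
qed

section \<open>Lower bound\<close>

lemma exists_config_with_many_angles:
  assumes "k + 3 \<le> n"
  shows "\<exists>P\<in>configs n k. (k + 1) * (n - k - 2) \<le> num_angles P"
proof -
  define m where "m = n - k"
  have m: "3 \<le> m" using assms by (simp add: m_def)
  \<comment> \<open>A full turn is scaled to length \<open>m\<close>, so the polygon vertices sit at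
    the integers below \<open>m\<close>. The summand 0 is the offset \<open>t\<close> of the
    definition of a regular polygon.\<close>
  define h where "h x = circle_point 0 1 (0 + 2 * pi * x / real m)" for x
  have h_inj: "inj_on h {0..<real m}"
  proof (rule inj_onI)
    fix x y assume "x \<in> {0..<real m}" "y \<in> {0..<real m}" "h x = h y"
    then have "2 * pi * x / real m = 2 * pi * y / real m"
      using m by (intro inj_onD[OF circle_point_inj[of 1 0]]) (auto simp: h_def field_simps)
    then show "x = y" using m by (simp add: field_simps)
  qed
  \<comment> \<open>\<open>e 0\<close> is the first vertex; \<open>e 1\<close> to \<open>e k\<close>
    are the extra points, strictly between the vertices 0 and 1.\<close>
  define e where "e i = real i / real (k + 1)" for i
  have e: "0 \<le> e i" "e i < 1" if "i \<le> k" for i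
    using that by (auto simp: e_def field_simps)
  have e_pos: "0 < e i" if "1 \<le> i" for i
    using that by (auto simp: e_def)
  have e_inj: "inj e" by (auto simp: inj_on_def e_def)
  define X where "X = real ` {..<m} \<union> e ` {1..k}"
  have X: "X \<subseteq> {0..<real m}"
  proof -
    have "e i < real m" if "i \<le> k" for i using e[OF that] m by linarith
    then show ?thesis using e m by (auto simp: X_def)
  qed
  have cX: "card X = n"
  proof -
    have "real ` {..<m} \<inter> e ` {1..k} = {}"
    proof -
      have "real j \<noteq> e i" if "i \<in> {1..k}" for i j
        using e[of i] e_pos[of i] that by (cases j) auto
      then show ?thesis by blast
    qed
    then have "card X = card (real ` {..<m}) + card (e ` {1..k})"
      unfolding X_def by (intro card_Un_disjoint) auto
    also have "\<dots> = m + k"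
      using e_inj by (subst (1 2) card_image) (auto simp: inj_on_def)
    finally show ?thesis using assms by (simp add: m_def)
  qed
  have fX: "finite X" by (simp add: X_def)
  have h_eq: "h x = h y \<longleftrightarrow> x = y" if "x \<in> X" "y \<in> X" for x y
    using h_inj X that by (auto simp: inj_on_def)
  define P where "P = h ` X"
  have "card P = n"
    unfolding P_def using h_inj X cX by (subst card_image) (auto intro: inj_on_subset)
  moreover have "P \<subseteq> sphere 0 1"
    unfolding P_def h_def by (intro image_subsetI circle_point_in_sphere) simp
  moreover have "h ` real ` {..<m} \<subseteq> P" by (auto simp: P_def X_def)
  moreover have "regular_polygon_on 0 1 (n - k) (h ` real ` {..<m})"
    using m unfolding regular_polygon_on_def h_def m_def image_image by (intro conjI exI[of _ 0]) auto
  ultimately have conf: "P \<in> configs n k"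
    unfolding configs_def using finite_imageI[OF fX, of h, folded P_def] zero_less_one[where 'a = real]
    by blast
  \<comment> \<open>Half the central angle from \<open>e i\<close> to \<open>j\<close>. The index
    \<open>j\<close> starts at 1 to exceed every \<open>e i\<close>, and stops at
    \<open>m - 2\<close> because \<open>m - 1\<close> is the viewing vertex.\<close>
  define g where "g = (\<lambda>(i, j). pi * (real j - e i) / real m)"
  have g_inj: "inj_on g ({..k} \<times> {1..m - 2})"
  proof (rule inj_onI)
    fix u v assume u: "u \<in> {..k} \<times> {1..m - 2}" and v: "v \<in> {..k} \<times> {1..m - 2}" and eq: "g u = g v"
    obtain i j i' j' where uv: "u = (i, j)" "v = (i', j')" by (cases u, cases v)
    have *: "real j - e i = real j' - e i'"
      using eq m by (simp add: g_def uv)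
    have "e i < 1" "0 \<le> e i" "e i' < 1" "0 \<le> e i'" using e u v uv by auto
    \<comment> \<open>Since the offsets \<open>e i\<close> and \<open>e i'\<close> lie in the
      half-open unit interval, equal differences force equal integers and then equal
      offsets.\<close>
    then have "real j < real j' + 1" "real j' < real j + 1" using * by linarith+
    then have "j = j'" by linarith
    with * show "u = v" using e_inj by (auto simp: uv inj_on_def)
  qed
  have "g ` ({..k} \<times> {1..m - 2}) \<subseteq> angles P"
  proof (intro image_subsetI)
    fix u assume "u \<in> {..k} \<times> {1..m - 2}"
    then obtain i j where u: "u = (i, j)" and i: "i \<le> k" and j: "1 \<le> j" "j < m - 1" using m by auto
    have e0: "e 0 = 0" by (simp add: e_def)
    have X3: "e i \<in> X" "real j \<in> X" "real (m - 1) \<in> X"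
    proof -
      have "m - 1 \<in> {..<m}" using m by simp
      then show "real (m - 1) \<in> X" unfolding X_def by blast
      show "e i \<in> X"
        using i m e0 by (cases "i = 0") (auto simp: X_def intro: image_eqI[of _ _ 0])
    qed (use j m in \<open>auto simp: X_def\<close>)
    have ord: "0 \<le> e i" "e i < real j" "real j < real (m - 1)" "real (m - 1) < real m"
      using e[OF i] j m by auto
    have "angle_at (h (e i)) (h (real (m - 1))) (h (real j)) =
        (0 + 2 * pi * real j / real m - (0 + 2 * pi * e i / real m)) / 2"
      unfolding h_def
    proof (rule angle_at_circle_point_ordered)
      show "0 + 2 * pi * e i / real m < 0 + 2 * pi * real j / real m"
        "0 + 2 * pi * real j / real m < 0 + 2 * pi * real (m - 1) / real m"
        using ord m by (auto intro!: divide_strict_right_mono)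
      have "2 * pi * real (m - 1) / real m < 2 * pi" using m by (simp add: field_simps)
      moreover have "0 \<le> 2 * pi * e i / real m" using ord by simp
      ultimately show "0 + 2 * pi * real (m - 1) / real m < 0 + 2 * pi * e i / real m + 2 * pi"
        by linarith
    qed simp
    also have "\<dots> = g u" by (simp add: g_def u diff_divide_distrib right_diff_distrib)
    finally have "g u = angle_at (h (e i)) (h (real (m - 1))) (h (real j))" ..
    moreover have "0 < g u" using ord m by (simp add: g_def u)
    moreover have "g u < pi"
    proof -
      have "real j - e i < real m" using ord by linarith
      then show ?thesis using m by (simp add: g_def u divide_less_eq)
    qed
    moreover have "h (e i) \<noteq> h (real (m - 1))" "h (real (m - 1)) \<noteq> h (real j)" "h (e i) \<noteq> h (real j)"
      using X3 ord by (subst h_eq; linarith)+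
    moreover have "h (e i) \<in> P" "h (real (m - 1)) \<in> P" "h (real j) \<in> P"
      using X3 by (auto simp: P_def)
    ultimately show "g u \<in> angles P" unfolding angles_def by blast
  qed
  moreover have "finite (angles P)"
  proof (rule finite_subset)
    show "angles P \<subseteq> (\<lambda>(p, q, r). angle_at p q r) ` (P \<times> P \<times> P)"
      by (force simp: angles_def)
  qed (use fX in \<open>simp add: P_def\<close>)
  ultimately have "card (g ` ({..k} \<times> {1..m - 2})) \<le> num_angles P"
    unfolding num_angles_def by (intro card_mono)
  then have "(k + 1) * (n - k - 2) \<le> num_angles P"
    using g_inj by (simp add: card_image card_cartesian_product m_def)
  with conf show ?thesis by blast
qed

section \<open>Bounds for the maximum and asymptotics\<close>

lemma max_angles_le:
  assumes "k + 3 \<le> n"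
  shows "max_angles n k \<le> 2 * ((k + 1) * n)"
  unfolding max_angles_def
  using finite_num_angles_configs configs_nonempty[OF assms] num_angles_configs_le
  by (subst Max_le_iff) auto

lemma max_angles_ge:
  assumes "k + 3 \<le> n"
  shows "(k + 1) * (n - k - 2) \<le> max_angles n k"
proof -
  obtain P where "P \<in> configs n k" "(k + 1) * (n - k - 2) \<le> num_angles P"
    using exists_config_with_many_angles[OF assms] by blast
  then show ?thesis
    unfolding max_angles_def using finite_num_angles_configs
    by (meson Max_ge image_eqI order_trans)
qed

text \<open>With \<open>k + 1\<close> in place of \<open>k\<close> this includes
  \<open>k = 0\<close>. Only the threshold for \<open>n\<close> depends on \<open>k\<close>, not the
  constants.\<close>

lemma eventually_max_angles_bounds:
  "\<forall>\<^sub>F n in sequentially.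
    1 / 2 * (real n * real (k + 1)) \<le> real (max_angles n k) \<and>
    real (max_angles n k) \<le> 2 * (real n * real (k + 1))"
  \<comment> \<open>Exactly the condition for \<open>n \<le> 2 * (n - k - 2)\<close>, the source of
    the factor 1/2.\<close>
  using eventually_ge_at_top[of "2 * k + 4"]
proof eventually_elim
  case (elim n)
  have "(k + 1) * n \<le> (k + 1) * (2 * (n - k - 2))" using elim by (intro mult_le_mono2) linarith
  also have "\<dots> \<le> 2 * max_angles n k" using max_angles_ge[of k n] elim by simp
  finally have "real ((k + 1) * n) \<le> real (2 * max_angles n k)" by (rule of_nat_mono)
  moreover have "real (max_angles n k) \<le> real (2 * ((k + 1) * n))"
    using max_angles_le[of k n] elim by (intro of_nat_mono) simp
  ultimately show ?case by (simp only: of_nat_mult of_nat_numeral mult.commute) simp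
qed

text \<open>The second conjunct makes the constants uniform in \<open>k\<close>. For
  \<open>k = 0\<close> the product \<open>n * k\<close> vanishes, while the polygon alone has
  linearly many angles; hence the comparison with \<open>n\<close>.\<close>

theorem proposition3p2:
  shows "(\<forall>k::nat. k \<ge> 1 \<longrightarrow>
            (\<lambda>n. real (max_angles n k)) \<in> \<Theta>(\<lambda>n. real n * real k)) \<and>
         (\<exists>c C :: real. 0 < c \<and> 0 < C \<and>
            (\<forall>k::nat. k \<ge> 1 \<longrightarrow>
               (\<forall>\<^sub>F n in sequentially.
                  c * (real n * real k) \<le> real (max_angles n k) \<and>
                  real (max_angles n k) \<le> C * (real n * real k)))) \<and>
         (\<lambda>n. real (max_angles n 0)) \<in> \<Theta>(\<lambda>n. real n)"
proof -
  have bounds: "\<forall>\<^sub>F n in sequentially.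
      1 / 2 * (real n * real k) \<le> real (max_angles n k) \<and>
      real (max_angles n k) \<le> 4 * (real n * real k)" if "k \<ge> 1" for k
    using eventually_max_angles_bounds[of k]
  proof eventually_elim
    case (elim n)
    \<comment> \<open>For \<open>k \<ge> 1\<close>, replacing \<open>k + 1\<close> by
      \<open>2 * k\<close> doubles the upper constant from 2 to 4.\<close>
    have "real n * real k \<le> real n * real (k + 1)" "real n * real (k + 1) \<le> real n * (2 * real k)"
      using that by (intro mult_left_mono; simp)+
    with elim show ?case by linarith
  qed
  have theta: "(\<lambda>n. real (max_angles n k)) \<in> \<Theta>(f)"
    if "\<forall>\<^sub>F n in sequentially. 1 / 2 * f n \<le> real (max_angles n k) \<and>
      real (max_angles n k) \<le> C * f n" "\<And>n. 0 \<le> f n" for k C and f :: "nat \<Rightarrow> real"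
    using that by (intro bigthetaI bigoI[of _ C] landau_omega.bigI[of "1 / 2"])
      (auto elim!: eventually_mono)
  have "(\<lambda>n. real (max_angles n 0)) \<in> \<Theta>(\<lambda>n. real n)"
    using eventually_max_angles_bounds[of 0] by (intro theta[of _ _ 2]) auto
  moreover have "(\<lambda>n. real (max_angles n k)) \<in> \<Theta>(\<lambda>n. real n * real k)" if "k \<ge> 1" for k
    using bounds[OF that] by (intro theta[of _ _ 4]) auto
  ultimately show ?thesis
    using bounds by (intro conjI exI[of _ "1 / 2 :: real"] exI[of _ "4 :: real"]) auto
qed

end
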